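(* Let $m$ be a positive integer, let $M_1,\dots,M_{m-1}\ge 0$ and let $\Lambda$ be a real number. Let $F(z)=\sum_{k=0}^{m-1}\bar z^k f_k(z)$ be a poly-analytic function of order $m$ on $\mathbb{D}$, where all $f_k$ are holomorphic on $\mathbb{D}$, satisfying $f_k(0)=0$ for $k\in\{0,1,\dots,m-1\}$ and $F_z(0)=1$. Suppose that $|f_0'(z)|<\Lambda$ and $|f_k(z)|\le M_k$ for $k\in\{1,\dots,m-1\}$, for all $z\in\mathbb{D}$. Then $\Lambda>1$, $F$ is univalent in $\mathbb{D}_{r_1}$, and $F(\mathbb{D}_{r_1})$ contains a schlicht disc $\mathbb{D}_{R_1}$, where $r_1$ is the unique root in $(0,1)$ of the equation $$\frac{\Lambda(1-\Lambda r)}{\Lambda-r}-\sum_{k=1}^{m-1}r^k\left(\frac{M_k}{1-r^2}+kM_k\right)=0$$ and $$R_1=\Lambda^2 r_1+(\Lambda^3-\Lambda)\ln\left(1-\frac{r_1}{\Lambda}\right)-\sum_{k=1}^{m-1}r_1^{k+1}M_k.$$ Moreover, when $M_k=0$ for all $k\in\{1,\dots,m-1\}$, the result is sharp: for every $\Lambda>1$, there is no $r\in(r_1,1]$ such that every such $F$ is univalent in $\mathbb{D}_r$, and there is no $R>R_1$ such that $F(\mathbb{D}_{r_1})\supseteq\mathbb{D}_R$ for every such $F$.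
   Context: $\mathbb{D}=\{z\in\mathbb{C}:|z|<1\}$ and $\mathbb{D}_r=\{z\in\mathbb{C}:|z|<r\}$. A complex-valued $C^m$ function $F$ on a domain is poly-analytic of order $m\ge1$ if $\partial^m F/\partial\bar z^m=0$; equivalently $F(z)=\sum_{k=0}^{m-1}\bar z^k f_k(z)$ with $f_k$ analytic. $F_z=\partial F/\partial z$ is the Wirtinger derivative. Univalent means injective. "$F(\mathbb{D}_{r})$ contains a schlicht disc $\mathbb{D}_{R}$" means that some subdomain of $\mathbb{D}_r$ is mapped injectively by $F$ onto $\mathbb{D}_R$; as $F$ is univalent in $\mathbb{D}_r$ this amounts to $\mathbb{D}_R\subseteq F(\mathbb{D}_r)$. Empty sums are $0$. *)

theory Defs
  imports "HOL-Complex_Analysis.Complex_Analysis"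
begin

definition wirtinger_z :: "(complex \<Rightarrow> complex) \<Rightarrow> complex \<Rightarrow> complex" where
  "wirtinger_z F z =
     (vector_derivative (\<lambda>x. F (z + of_real x)) (at 0)
        - \<i> * vector_derivative (\<lambda>y. F (z + \<i> * of_real y)) (at 0)) / 2"

(* The functions f k with k \<ge> m and the values M k with k = 0 or k \<ge> m play no role;
   F is only constrained on the unit disc. *)
definition admissible ::
  "nat \<Rightarrow> (nat \<Rightarrow> real) \<Rightarrow> real \<Rightarrow> (nat \<Rightarrow> complex \<Rightarrow> complex) \<Rightarrow> (complex \<Rightarrow> complex) \<Rightarrow> bool" where
  "admissible m M \<Lambda> f F \<longleftrightarrow>
     (\<forall>k<m. f k holomorphic_on ball 0 1) \<and>
     (\<forall>z\<in>ball 0 1. F z = (\<Sum>k<m. cnj z ^ k * f k z)) \<and>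
     (\<forall>k<m. f k 0 = 0) \<and>
     wirtinger_z F 0 = 1 \<and>
     (\<forall>z\<in>ball 0 1. norm (deriv (f 0) z) < \<Lambda>) \<and>
     (\<forall>k\<in>{1..<m}. \<forall>z\<in>ball 0 1. norm (f k z) \<le> M k)"

definition contains_schlicht_disc :: "(complex \<Rightarrow> complex) \<Rightarrow> complex set \<Rightarrow> real \<Rightarrow> bool" where
  "contains_schlicht_disc F S R \<longleftrightarrow>
     (\<exists>U. U \<subseteq> S \<and> open U \<and> connected U \<and> U \<noteq> {} \<and> inj_on F U \<and> F ` U = ball 0 R)"

definition radius_eq :: "nat \<Rightarrow> (nat \<Rightarrow> real) \<Rightarrow> real \<Rightarrow> real \<Rightarrow> real" where
  "radius_eq m M \<Lambda> r =
     \<Lambda> * (1 - \<Lambda> * r) / (\<Lambda> - r)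
       - (\<Sum>k\<in>{1..<m}. r ^ k * (M k / (1 - r\<^sup>2) + real k * M k))"

definition schlicht_radius :: "nat \<Rightarrow> (nat \<Rightarrow> real) \<Rightarrow> real \<Rightarrow> real \<Rightarrow> real" where
  "schlicht_radius m M \<Lambda> r =
     \<Lambda>\<^sup>2 * r + (\<Lambda> ^ 3 - \<Lambda>) * ln (1 - r / \<Lambda>) - (\<Sum>k\<in>{1..<m}. r ^ (k + 1) * M k)"

end

theory Submission
  imports Defs
begin

text \<open>
  Since \<open>F\<^sub>z(0) = f\<^sub>0'(0) = 1\<close>, the Schwarz--Pick lemma for \<open>f\<^sub>0' / \<Lambda>\<close> gives
  \<open>Re f\<^sub>0'(z) \<ge> \<Lambda>(1 - \<Lambda>|z|)/(\<Lambda> - |z|)\<close>, while \<open>|f\<^sub>k| \<le> M\<^sub>k|z|\<close> and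
  \<open>|f\<^sub>k'| \<le> M\<^sub>k/(1 - |z|\<^sup>2)\<close> bound the Lipschitz constant of each remaining term on a disc.
  Hence \<open>|F(z) - F(w)| \<ge> radius_eq(r) |z - w|\<close> on the disc of radius \<open>r\<close>, and \<open>radius_eq\<close>
  is decreasing, so \<open>F\<close> is univalent up to its root. Integrating the bound on \<open>Re f\<^sub>0'\<close> along
  radii gives \<open>|F| \<ge> R\<^sub>1\<close> on the circle of radius \<open>r\<^sub>1\<close>, and invariance of domain makes the
  image contain the disc of radius \<open>R\<^sub>1\<close>. For sharpness, integrate the Moebius map attaining
  the Schwarz--Pick bound: its only critical point is \<open>1 / \<Lambda> = r\<^sub>1\<close>, where it takes the value
  \<open>R\<^sub>1\<close>.
\<close>

section \<open>Schwarz and Schwarz-Pick estimates\<close>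

text \<open>\<open>Schwarz_Lemma\<close> asks for a strict bound by 1, so it is applied to
  \<open>f\<close> divided by \<open>M + e\<close>, and then \<open>e\<close> tends to 0. The shift
  also covers \<open>M = 0\<close>.\<close>

lemma Schwarz_bound:
  assumes "f holomorphic_on ball 0 1" "f 0 = 0"
    and le: "\<And>z. z \<in> ball 0 1 \<Longrightarrow> norm (f z) \<le> M" and z: "z \<in> ball 0 1"
  shows "norm (f z) \<le> M * norm z"
proof -
  have M: "0 \<le> M"
    using le[of 0] assms(2) by simp
  have *: "norm (f z) \<le> (M + e) * norm z" if "e > 0" for e :: real
  proof -
    have pos: "M + e > 0" using M that by simp
    have "norm (f z / of_real (M + e)) \<le> norm z"
    proof (rule Schwarz_Lemma(1)[of "\<lambda>z. f z / of_real (M + e)"])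
      show "(\<lambda>z. f z / of_real (M + e)) holomorphic_on ball 0 1"
        using pos assms(1) by (intro holomorphic_intros) (auto simp flip: of_real_add)
      show "norm (f w / of_real (M + e)) < 1" if "norm w < 1" for w
      proof -
        have "norm (f w) < M + e"
          using le[of w] that \<open>e > 0\<close> by simp
        then show ?thesis
          using pos by (simp only: norm_divide norm_of_real abs_of_pos) simp
      qed
    qed (use assms z in auto)
    then show ?thesis
      using pos by (simp only: norm_divide norm_of_real abs_of_pos) (simp add: field_simps)
  qed
  have "((\<lambda>e. (M + e) * norm z) \<longlongrightarrow> (M + 0) * norm z) (at_right 0)"
    by (intro tendsto_intros)
  moreover have "eventually (\<lambda>e. norm (f z) \<le> (M + e) * norm z) (at_right 0)"
    using * by (auto simp: eventually_at_right_less intro!: eventually_at_rightI[of 0 1])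
  ultimately show ?thesis
    using tendsto_lowerbound by fastforce
qed

lemma Moebius_function_deriv_of_zero:
  "(Moebius_function 0 w has_field_derivative of_real (1 - (norm w)\<^sup>2)) (at 0)"
  unfolding Moebius_function_simple[abs_def]
  by (auto intro!: derivative_eq_intros simp: complex_norm_square[unfolded of_real_power] algebra_simps)

text \<open>Precomposing with the disc automorphism that sends 0 to \<open>w\<close> moves the
  problem to the origin and contributes the chain-rule factor \<open>1 - (norm w)\<^sup>2\<close>.
  Cauchy's inequality on circles of radius \<open>\<rho>\<close> below 1 then bounds the derivative
  at 0, and \<open>\<rho>\<close> tends to 1.\<close>

lemma Schwarz_Pick_deriv:
  assumes holf: "f holomorphic_on ball 0 1"
    and le: "\<And>z. z \<in> ball 0 1 \<Longrightarrow> norm (f z) \<le> M" and w: "w \<in> ball 0 1"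
  shows "norm (deriv f w) \<le> M / (1 - (norm w)\<^sup>2)"
proof -
  let ?T = "Moebius_function 0 (- w)"
  define g where "g = f \<circ> ?T"
  have T0: "?T 0 = w"
    by (simp add: Moebius_function_of_zero)
  have maps: "?T z \<in> ball 0 1" if "z \<in> ball 0 1" for z
    using that w Moebius_function_norm_lt_1[of "- w" z 0] by simp
  have holg: "g holomorphic_on ball 0 1"
    unfolding g_def
    by (rule holomorphic_on_compose_gen[OF _ holf]) (use maps w in \<open>auto intro!: Moebius_function_holomorphic\<close>)
  have d: "(g has_field_derivative deriv f w * of_real (1 - (norm w)\<^sup>2)) (at 0)"
    unfolding g_def
    by (rule DERIV_chain[where Da = "deriv f w"])
       (use holf w T0 Moebius_function_deriv_of_zero[of "- w"] in \<open>auto simp: holomorphic_derivI\<close>)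
  have *: "norm (deriv g 0) * \<rho> \<le> M" if "0 < \<rho>" "\<rho> < 1" for \<rho>
  proof -
    have "norm ((deriv ^^ 1) g 0) \<le> fact 1 * M / \<rho> ^ 1"
    proof (rule Cauchy_inequality)
      show "g holomorphic_on ball 0 \<rho>" "continuous_on (cball 0 \<rho>) g"
        using that by (auto intro!: holomorphic_on_imp_continuous_on intro: holomorphic_on_subset[OF holg])
      show "norm (g x) \<le> M" if "norm (0 - x) = \<rho>" for x
        using that \<open>\<rho> < 1\<close> maps[of x] le by (simp add: g_def)
    qed fact
    then show ?thesis
      using that by (simp add: field_simps)
  qed
  have "((\<lambda>\<rho>. norm (deriv g 0) * \<rho>) \<longlongrightarrow> norm (deriv g 0) * 1) (at_left 1)"
    by (intro tendsto_intros)
  moreover have "eventually (\<lambda>\<rho>. norm (deriv g 0) * \<rho> \<le> M) (at_left 1)"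
    using * by (auto intro!: eventually_at_leftI[of 0 1])
  ultimately have "norm (deriv g 0) * 1 \<le> M"
    by (rule tendsto_upperbound) simp
  moreover have "(norm w)\<^sup>2 < 1"
    using w by (simp add: power_less_one_iff)
  ultimately show ?thesis
    using DERIV_imp_deriv[OF d] by (simp add: norm_mult field_simps del: of_real_diff)
qed

text \<open>The function \<open>h\<close>, which is \<open>g\<close> divided by \<Lambda>, maps the
  disc into itself and takes the value \<open>a\<close> at 0. Moving \<open>a\<close> to 0 by a
  Moebius map and applying Schwarz confines \<open>h z\<close> to a pseudohyperbolic disc about
  \<open>a\<close> of radius \<open>r\<close>. That disc is symmetric about the real axis and its
  leftmost point is \<open>(a - r) / (1 - a * r)\<close>.\<close>

lemma Schwarz_Pick_Re_lower_bound:
  assumes holg: "g holomorphic_on ball 0 1" and g0: "g 0 = 1"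
    and less: "\<And>z. z \<in> ball 0 1 \<Longrightarrow> norm (g z) < \<Lambda>" and z: "z \<in> ball 0 1"
  shows "Re (g z) \<ge> \<Lambda> * (1 - \<Lambda> * norm z) / (\<Lambda> - norm z)"
proof -
  have L: "\<Lambda> > 1" using less[of 0] g0 by simp
  define a where "a = 1 / \<Lambda>"
  define r where "r = norm z"
  define h where "h = (\<lambda>z. g z / of_real \<Lambda>)"
  have a: "0 < a" "a < 1" using L by (auto simp: a_def)
  have r: "0 \<le> r" "r < 1" using z by (auto simp: r_def)
  have h1: "norm (h w) < 1" if "w \<in> ball 0 1" for w
    using less[OF that] L by (simp add: h_def norm_divide)
  let ?T = "Moebius_function 0 (of_real a)"
  have "norm ((?T \<circ> h) z) \<le> norm z"
  proof (rule Schwarz_Lemma(1))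
    have "h holomorphic_on ball 0 1"
      unfolding h_def using L holg by (intro holomorphic_intros) auto
    then show "(?T \<circ> h) holomorphic_on ball 0 1"
      by (rule holomorphic_on_compose_gen)
         (use h1 a in \<open>auto intro!: Moebius_function_holomorphic\<close>)
    show "(?T \<circ> h) 0 = 0"
      by (simp add: h_def g0 a_def Moebius_function_def)
    show "norm ((?T \<circ> h) w) < 1" if "norm w < 1" for w
      using Moebius_function_norm_lt_1[of "of_real a" "h w" 0] h1[of w] that a by simp
  qed (use z in auto)
  then have "norm (h z - of_real a) / norm (1 - of_real a * h z) \<le> r"
    by (simp add: Moebius_function_simple r_def norm_divide)
  moreover have "norm (of_real a * h z) < 1"
    using h1[OF z] a mult_strict_mono[of a 1 "norm (h z)" 1] by (simp add: norm_mult)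
  then have "1 - of_real a * h z \<noteq> 0"
    by force
  ultimately have "norm (h z - of_real a) \<le> r * norm (1 - of_real a * h z)"
    by (simp add: field_simps)
  then have "(norm (h z - of_real a))\<^sup>2 \<le> (r * norm (1 - of_real a * h z))\<^sup>2"
    by (intro power_mono) auto
  then have *: "(Re (h z) - a)\<^sup>2 + (Im (h z))\<^sup>2 \<le> r\<^sup>2 * ((1 - a * Re (h z))\<^sup>2 + (a * Im (h z))\<^sup>2)"
    by (simp add: power_mult_distrib cmod_power2)
  have "r * a \<le> 1"
    using a r mult_mono[of r 1 a 1] by simp
  then have "(r * a)\<^sup>2 \<le> 1"
    using a r by (simp add: power_le_one)
  then have "(r * a)\<^sup>2 * (Im (h z))\<^sup>2 \<le> 1 * (Im (h z))\<^sup>2"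
    by (intro mult_right_mono) auto
  with * have "(Re (h z) - a)\<^sup>2 \<le> (r * (1 - a * Re (h z)))\<^sup>2"
    unfolding power_mult_distrib distrib_left by (simp add: mult_ac)
  moreover have "a * Re (h z) \<le> 1"
  proof -
    have "a * Re (h z) \<le> a * 1"
      using a h1[OF z] complex_Re_le_cmod[of "h z"] by (intro mult_left_mono) auto
    then show ?thesis using a by linarith
  qed
  then have "0 \<le> r * (1 - a * Re (h z))"
    using r by simp
  ultimately have "\<bar>Re (h z) - a\<bar> \<le> r * (1 - a * Re (h z))"
    by (simp add: abs_le_square_iff[symmetric])
  then have "Re (h z) * (1 - a * r) \<ge> a - r"
    by (simp add: algebra_simps abs_le_iff)
  moreover have "Re (h z) = a * Re (g z)"
    by (simp add: h_def a_def)
  ultimately have "a * Re (g z) * (1 - a * r) \<ge> a - r" by simp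
  then have "\<Lambda> * (\<Lambda> * (1 - \<Lambda> * r)) \<le> \<Lambda> * (Re (g z) * (\<Lambda> - r))"
    using L by (simp add: a_def field_simps power2_eq_square)
  then have "Re (g z) * (\<Lambda> - r) \<ge> \<Lambda> * (1 - \<Lambda> * r)"
    using L by (simp only: mult_le_cancel_left_pos)
  then show ?thesis
    using L r by (simp add: r_def[symmetric] field_simps)
qed

section \<open>Growth estimates from the real part of the derivative\<close>

lemma DERIV_Re_along_line:
  assumes "(f has_field_derivative D) (at (a + of_real t * d))"
  shows "((\<lambda>t. Re (c * f (a + of_real t * d))) has_real_derivative Re (c * (D * d))) (at t)"
proof -
  have "((\<lambda>t. a + of_real t * d) has_vector_derivative d) (at t)"
    by (auto intro!: derivative_eq_intros simp: has_vector_derivative_def scaleR_conv_of_real)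
  from field_vector_diff_chain_at[OF this assms]
  have "((\<lambda>t. f (a + of_real t * d)) has_vector_derivative d * D) (at t)"
    by (simp add: o_def)
  then have "((\<lambda>t. c * f (a + of_real t * d)) has_vector_derivative c * (d * D)) (at t)"
    by (auto intro!: derivative_eq_intros)
  then show ?thesis
    unfolding has_real_derivative_iff_has_vector_derivative
    using bounded_linear.has_vector_derivative[OF bounded_linear_Re] by (fastforce simp: mult.commute)
qed

text \<open>The mean value theorem fails for complex-valued functions, but it applies to the real
  part along a segment. The factor \<open>cnj (z - w)\<close> cancels the direction of the segment,
  so that only \<open>Re (deriv f u)\<close> remains.\<close>

lemma holomorphic_Re_mvt:
  assumes "f holomorphic_on S" "open S" "closed_segment w z \<subseteq> S" "w \<noteq> z"
  obtains u where "u \<in> open_segment w z"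
    "Re (cnj (z - w) * (f z - f w)) = (norm (z - w))\<^sup>2 * Re (deriv f u)"
proof -
  define d where "d = z - w"
  have seg: "w + of_real t * d \<in> S" if "0 \<le> t" "t \<le> 1" for t
  proof -
    have "w + of_real t * d \<in> closed_segment w z"
      using that by (auto simp: closed_segment_def d_def algebra_simps scaleR_conv_of_real)
    then show ?thesis using assms(3) by blast
  qed
  let ?\<phi> = "\<lambda>t. Re (cnj d * f (w + of_real t * d))"
  have "\<exists>t>0. t < 1 \<and> ?\<phi> 1 - ?\<phi> 0 = (1 - 0) * Re (cnj d * (deriv f (w + of_real t * d) * d))"
    by (rule MVT2, simp, rule DERIV_Re_along_line, rule holomorphic_derivI[OF assms(1,2)], rule seg)
  then obtain t where t: "0 < t" "t < 1"
    and eq: "?\<phi> 1 - ?\<phi> 0 = Re (cnj d * (deriv f (w + of_real t * d) * d))"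
    by auto
  have "cnj d * (deriv f (w + of_real t * d) * d) = of_real ((norm d)\<^sup>2) * deriv f (w + of_real t * d)"
    unfolding complex_norm_square by (simp add: algebra_simps)
  then have "Re (cnj (z - w) * (f z - f w)) = (norm (z - w))\<^sup>2 * Re (deriv f (w + of_real t * d))"
    using eq by (simp add: d_def algebra_simps)
  moreover have "w + of_real t * d \<in> open_segment w z"
    using t assms(4) by (auto simp: in_segment d_def algebra_simps scaleR_conv_of_real intro!: exI[of _ t])
  ultimately show ?thesis
    using that by blast
qed

text \<open>A quantitative form of the Noshiro-Warschawski criterion for univalence.\<close>

lemma holomorphic_expansive_if_Re_deriv_ge:
  assumes "f holomorphic_on S" "open S" "closed_segment w z \<subseteq> S"
    and Re: "\<And>u. u \<in> open_segment w z \<Longrightarrow> Re (deriv f u) \<ge> c"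
  shows "c * norm (z - w) \<le> norm (f z - f w)"
proof (cases "z = w")
  case False
  then obtain u where u: "u \<in> open_segment w z"
    "Re (cnj (z - w) * (f z - f w)) = (norm (z - w))\<^sup>2 * Re (deriv f u)"
    using holomorphic_Re_mvt[OF assms(1-3)] by blast
  have "(norm (z - w))\<^sup>2 * c \<le> (norm (z - w))\<^sup>2 * Re (deriv f u)"
    using u(1) Re by (intro mult_left_mono) auto
  also have "\<dots> \<le> norm (z - w) * norm (f z - f w)"
    using complex_Re_le_cmod[of "cnj (z - w) * (f z - f w)"] u(2)
    by (simp add: norm_mult del: complex_cnj_diff)
  finally show ?thesis
    using False by (simp add: power2_eq_square mult.commute)
qed simp

text \<open>Positivity is asked only on the open segment, so an endpoint may be a critical point.
  The sharpness argument uses exactly this case.\<close>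

lemma holomorphic_neq_if_Re_deriv_pos:
  assumes "f holomorphic_on S" "open S" "closed_segment w z \<subseteq> S" "w \<noteq> z"
    and "\<And>u. u \<in> open_segment w z \<Longrightarrow> Re (deriv f u) > 0"
  shows "f w \<noteq> f z"
proof
  assume "f w = f z"
  moreover obtain u where "u \<in> open_segment w z"
    "Re (cnj (z - w) * (f z - f w)) = (norm (z - w))\<^sup>2 * Re (deriv f u)"
    using holomorphic_Re_mvt[OF assms(1-4)] by blast
  ultimately show False
    using assms(4,5) by fastforce
qed

text \<open>This integrates the bound along the ray from 0 to \<open>z\<close>. In place of an
  integral, the real part of \<open>f\<close> in the direction of \<open>z\<close>, minus the
  primitive \<open>P\<close>, is shown to be nondecreasing.\<close>

lemma norm_ge_if_Re_deriv_ge: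
  fixes f :: "complex \<Rightarrow> complex"
  assumes "f holomorphic_on ball 0 1" "f 0 = 0"
    and P: "\<And>t. 0 \<le> t \<Longrightarrow> t < 1 \<Longrightarrow> (P has_real_derivative p t) (at t)" "P 0 = 0"
    and ge: "\<And>u. u \<in> ball 0 1 \<Longrightarrow> Re (deriv f u) \<ge> p (norm u)"
    and z: "z \<in> ball 0 1"
  shows "P (norm z) \<le> norm (f z)"
proof (cases "z = 0")
  case False
  define d where "d = sgn z"
  have d: "norm d = 1" "z = 0 + of_real (norm z) * d"
    using False by (simp_all add: d_def norm_sgn) (simp add: sgn_eq)
  have dd: "cnj d * (w * d) = w" for w
    using d(1) complex_norm_square[of d] by (simp add: mult_ac)
  let ?\<phi> = "\<lambda>t. Re (cnj d * f (0 + of_real t * d)) - P t"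
  have "?\<phi> 0 \<le> ?\<phi> (norm z)"
  proof (rule DERIV_nonneg_imp_nondecreasing[where f = ?\<phi>])
    fix t assume t: "0 \<le> t" "t \<le> norm z"
    have b: "0 + of_real t * d \<in> ball 0 1"
      using t z d(1) by (simp add: norm_mult)
    have "(?\<phi> has_real_derivative Re (cnj d * (deriv f (0 + of_real t * d) * d)) - p t) (at t)"
      using t z b by (intro DERIV_diff DERIV_Re_along_line holomorphic_derivI[OF assms(1)] P) auto
    moreover have "p t \<le> Re (cnj d * (deriv f (0 + of_real t * d) * d))"
      unfolding dd using ge[OF b] t d(1) by (simp add: norm_mult)
    ultimately show "\<exists>y. (?\<phi> has_real_derivative y) (at t) \<and> 0 \<le> y"
      by (metis diff_ge_0_iff_ge)
  qed simp
  then have "P (norm z) \<le> Re (cnj d * f z)"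
    using d(2) assms(2) P(2) by (simp flip: d(2))
  also have "\<dots> \<le> norm (f z)"
    using complex_Re_le_cmod[of "cnj d * f z"] d(1) by (simp add: norm_mult)
  finally show ?thesis .
qed (use P in simp)

section \<open>The non-holomorphic terms and the Wirtinger derivative\<close>

text \<open>The product is differentiable only in the real sense, hence the Frechet derivative. At
  \<open>k = 0\<close> the truncated exponent \<open>k - 1\<close> is harmless because of the factor
  \<open>of_nat k\<close>.\<close>

lemma has_derivative_cnj_power_mult:
  fixes f :: "complex \<Rightarrow> complex"
  assumes "(f has_field_derivative D) (at z within S)"
  shows "((\<lambda>z. cnj z ^ k * f z) has_derivative
    (\<lambda>d. cnj z ^ k * (D * d) + of_nat k * cnj z ^ (k - 1) * cnj d * f z)) (at z within S)"
  using assms unfolding has_field_derivative_def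
  by (auto intro!: derivative_eq_intros simp: algebra_simps)

text \<open>The operator norm of the real derivative is bounded on the convex disc. Schwarz-Pick
  yields the summand \<open>M / (1 - r\<^sup>2)\<close>; differentiating the conjugate power yields
  \<open>real k * M\<close>.\<close>

lemma Lipschitz_cnj_power_mult:
  fixes f :: "complex \<Rightarrow> complex"
  assumes holf: "f holomorphic_on ball 0 1" and f0: "f 0 = 0"
    and le: "\<And>z. z \<in> ball 0 1 \<Longrightarrow> norm (f z) \<le> M" and k: "k \<ge> 1"
    and r: "r < 1" and zw: "z \<in> cball 0 r" "w \<in> cball 0 r"
  shows "norm (cnj z ^ k * f z - cnj w ^ k * f w) \<le> r ^ k * (M / (1 - r\<^sup>2) + real k * M) * norm (z - w)"
proof -
  have M: "0 \<le> M"
    using le[of 0] f0 by simp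
  have r0: "0 \<le> r"
    using zw norm_ge_zero[of z] by (simp del: norm_ge_zero)
  then have r1: "r\<^sup>2 < 1"
    using r by (simp add: power_less_one_iff)
  show ?thesis
  proof (rule differentiable_bound[OF convex_cball _ _ zw])
    fix u :: complex assume u: "u \<in> cball 0 r"
    then have u1: "u \<in> ball 0 1" and ur: "norm u \<le> r" using r by auto
    show "((\<lambda>z. cnj z ^ k * f z) has_derivative
      (\<lambda>d. cnj u ^ k * (deriv f u * d) + of_nat k * cnj u ^ (k - 1) * cnj d * f u)) (at u within cball 0 r)"
      by (intro has_derivative_cnj_power_mult holomorphic_derivI[OF holf] u1 open_ball)
    show "onorm (\<lambda>d. cnj u ^ k * (deriv f u * d) + of_nat k * cnj u ^ (k - 1) * cnj d * f u)
      \<le> r ^ k * (M / (1 - r\<^sup>2) + real k * M)"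
    proof (rule onorm_bound)
      show "0 \<le> r ^ k * (M / (1 - r\<^sup>2) + real k * M)"
        using M r0 r1 by simp
      fix d
      have ur2: "(norm u)\<^sup>2 \<le> r\<^sup>2" and urk: "norm u ^ k \<le> r ^ k"
        using ur by (auto intro: power_mono)
      have "norm (deriv f u) \<le> M / (1 - (norm u)\<^sup>2)"
        using Schwarz_Pick_deriv[OF holf le u1] .
      also have "\<dots> \<le> M / (1 - r\<^sup>2)"
        using ur2 r1 M by (intro divide_left_mono mult_pos_pos) auto
      finally have a: "norm u ^ k * norm (deriv f u) \<le> r ^ k * (M / (1 - r\<^sup>2))"
        using urk r0 by (intro mult_mono) auto
      \<comment> \<open>The factor \<open>norm u\<close> from the Schwarz lemma restores the power
        lost in differentiating \<open>cnj u ^ k\<close>.\<close>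
      have "norm u ^ (k - 1) * norm (f u) \<le> norm u ^ (k - 1) * (M * norm u)"
        by (intro mult_left_mono Schwarz_bound[OF holf f0 le u1]) auto
      also have "\<dots> = norm u ^ k * M"
        using k by (cases k) auto
      also have "\<dots> \<le> r ^ k * M"
        using urk M by (intro mult_right_mono)
      finally have b: "real k * (norm u ^ (k - 1) * norm (f u)) \<le> real k * (r ^ k * M)"
        by (intro mult_left_mono) auto
      have "norm (cnj u ^ k * (deriv f u * d) + of_nat k * cnj u ^ (k - 1) * cnj d * f u)
        \<le> (norm u ^ k * norm (deriv f u) + real k * (norm u ^ (k - 1) * norm (f u))) * norm d"
        by (rule order_trans[OF norm_triangle_ineq]) (simp add: norm_mult norm_power algebra_simps)
      also have "\<dots> \<le> (r ^ k * (M / (1 - r\<^sup>2)) + real k * (r ^ k * M)) * norm d"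
        using a b by (intro mult_right_mono add_mono) auto
      finally show "norm (cnj u ^ k * (deriv f u * d) + of_nat k * cnj u ^ (k - 1) * cnj d * f u)
        \<le> r ^ k * (M / (1 - r\<^sup>2) + real k * M) * norm d"
        by (simp add: algebra_simps)
    qed
  qed
qed

text \<open>At 0 every term with \<open>k \<ge> 1\<close> has zero derivative:
  \<open>cnj 0 ^ k\<close> kills one summand, and \<open>f k 0 = 0\<close> kills the other, which
  matters for \<open>k = 1\<close>. So \<open>F\<close> is complex differentiable at 0.\<close>

lemma wirtinger_z_eq_deriv:
  assumes hol: "\<And>k. k < m \<Longrightarrow> f k holomorphic_on ball 0 1" and m: "m \<ge> 1"
    and f0: "\<And>k. k < m \<Longrightarrow> f k 0 = 0"
    and F: "\<And>z. z \<in> ball 0 1 \<Longrightarrow> F z = (\<Sum>k<m. cnj z ^ k * f k z)"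
  shows "wirtinger_z F 0 = deriv (f 0) 0"
proof -
  have "((\<lambda>z. \<Sum>k<m. cnj z ^ k * f k z) has_derivative
    (\<lambda>d. \<Sum>k<m. cnj 0 ^ k * (deriv (f k) 0 * d) + of_nat k * cnj 0 ^ (k - 1) * cnj d * f k 0)) (at 0)"
    by (intro has_derivative_sum has_derivative_cnj_power_mult holomorphic_derivI[OF hol]) auto
  also have "(\<lambda>d. \<Sum>k<m. cnj 0 ^ k * (deriv (f k) 0 * d) + of_nat k * cnj 0 ^ (k - 1) * cnj d * f k 0)
    = (\<lambda>d. \<Sum>k<m. if k = 0 then deriv (f k) 0 * d else 0)"
    by (intro ext sum.cong) (auto simp: f0)
  also have "\<dots> = (\<lambda>d. deriv (f 0) 0 * d)"
    using m by (simp add: sum.delta)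
  finally have d: "(F has_derivative (\<lambda>d. deriv (f 0) 0 * d)) (at 0)"
    by (rule has_derivative_transform_within_open[of _ _ _ _ "ball 0 1"]) (auto simp: F)
  \<comment> \<open>The two partial derivatives in \<open>wirtinger_z\<close> are the cases
    \<open>c = 1\<close> and \<open>c = \<i>\<close>.\<close>
  have v: "vector_derivative (\<lambda>x. F (0 + c * of_real x)) (at 0) = c * deriv (f 0) 0" for c
  proof (rule vector_derivative_at)
    have "((\<lambda>x. 0 + c * of_real x) has_derivative (\<lambda>x. c * of_real x)) (at (0::real))"
      by (auto intro!: derivative_eq_intros)
    from diff_chain_at[OF this, of F] d
    have "((\<lambda>x. F (0 + c * of_real x)) has_derivative (\<lambda>x. deriv (f 0) 0 * (c * of_real x))) (at (0::real))"
      by (simp add: o_def)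
    then show "((\<lambda>x. F (0 + c * of_real x)) has_vector_derivative c * deriv (f 0) 0) (at 0)"
      by (simp add: has_vector_derivative_def scaleR_conv_of_real mult_ac)
  qed
  show ?thesis
    using v[of 1] v[of \<i>] by (simp add: wirtinger_z_def)
qed

section \<open>The radius equation and the schlicht radius\<close>

lemma pick_bound_strict_antimono:
  fixes \<Lambda> x y :: real
  assumes "\<Lambda> > 1" "x < y" "y < 1"
  shows "\<Lambda> * (1 - \<Lambda> * y) / (\<Lambda> - y) < \<Lambda> * (1 - \<Lambda> * x) / (\<Lambda> - x)"
proof -
  \<comment> \<open>This product is the difference of the two sides after clearing
    denominators.\<close>
  have "(y - x) * (\<Lambda>\<^sup>2 - 1) > 0"
    using assms one_less_power[of \<Lambda> 2] by simp
  then have "(1 - \<Lambda> * y) * (\<Lambda> - x) < (1 - \<Lambda> * x) * (\<Lambda> - y)"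
    by (simp add: algebra_simps power2_eq_square)
  then show ?thesis
    using assms by (simp add: divide_simps mult.assoc)
qed

lemma radius_eq_strict_antimono:
  assumes M: "\<forall>k\<in>{1..<m}. M k \<ge> 0" and "\<Lambda> > 1" "0 \<le> x" "x < y" "y < 1"
  shows "radius_eq m M \<Lambda> y < radius_eq m M \<Lambda> x"
proof -
  have y2: "y\<^sup>2 < 1" and xy2: "x\<^sup>2 \<le> y\<^sup>2"
    using assms by (auto simp: power_less_one_iff intro: power_mono)
  have "(\<Sum>k\<in>{1..<m}. x ^ k * (M k / (1 - x\<^sup>2) + real k * M k))
    \<le> (\<Sum>k\<in>{1..<m}. y ^ k * (M k / (1 - y\<^sup>2) + real k * M k))"
  proof (intro sum_mono mult_mono add_mono power_mono divide_left_mono)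
    fix k assume k: "k \<in> {1..<m}"
    show "0 < (1 - x\<^sup>2) * (1 - y\<^sup>2)"
      using xy2 y2 by simp
    show "0 \<le> M k / (1 - x\<^sup>2) + real k * M k"
      using M k xy2 y2 by simp
  qed (use assms xy2 in auto)
  then show ?thesis
    using pick_bound_strict_antimono[OF \<open>\<Lambda> > 1\<close> \<open>x < y\<close> \<open>y < 1\<close>]
    by (simp add: radius_eq_def)
qed

text \<open>The function is 1 at 0 and at most 0 at \<open>1 / \<Lambda>\<close>, where the Pick
  term vanishes. The interval between these points avoids the poles at 1 and \<Lambda>, so the
  intermediate value theorem applies. Uniqueness is strict monotonicity.\<close>

lemma radius_eq_unique_root:
  assumes M: "\<forall>k\<in>{1..<m}. M k \<ge> 0" and L: "\<Lambda> > 1"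
  obtains r1 where "{r. 0 < r \<and> r < 1 \<and> radius_eq m M \<Lambda> r = 0} = {r1}"
proof -
  have i: "0 < 1 / \<Lambda>" "1 / \<Lambda> < 1"
    using L by auto
  then have i2: "(1 / \<Lambda>)\<^sup>2 < 1"
    by (simp add: power_less_one_iff del: power_divide)
  have "(\<Sum>k\<in>{1..<m}. (1 / \<Lambda>) ^ k * (M k / (1 - (1 / \<Lambda>)\<^sup>2) + real k * M k)) \<ge> 0"
    using M i i2 by (intro sum_nonneg mult_nonneg_nonneg add_nonneg_nonneg divide_nonneg_nonneg) auto
  then have le: "radius_eq m M \<Lambda> (1 / \<Lambda>) \<le> 0"
    using L by (simp add: radius_eq_def)
  have "(\<Sum>k\<in>{1..<m}. 0 ^ k * (M k / (1 - 0\<^sup>2) + real k * M k)) = 0"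
    by (intro sum.neutral) auto
  then have zero: "radius_eq m M \<Lambda> 0 = 1"
    using L unfolding radius_eq_def by simp
  have "1 - x\<^sup>2 \<noteq> 0" "\<Lambda> - x \<noteq> 0" if "x \<in> {0..1 / \<Lambda>}" for x
  proof -
    have "0 \<le> x" "x < 1"
      using that i by (auto intro: le_less_trans)
    then show "1 - x\<^sup>2 \<noteq> 0" "\<Lambda> - x \<noteq> 0"
      using L power_less_one_iff[of x 2] by auto
  qed
  then have "continuous_on {0..1 / \<Lambda>} (radius_eq m M \<Lambda>)"
    unfolding radius_eq_def by (intro continuous_intros) auto
  then obtain r1 where r1: "0 \<le> r1" "r1 \<le> 1 / \<Lambda>" "radius_eq m M \<Lambda> r1 = 0"
    using IVT2'[of "radius_eq m M \<Lambda>" "1 / \<Lambda>" 0 0] le zero i by auto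
  moreover have "r1 \<noteq> 0"
    using r1 zero by auto
  ultimately have r1': "0 < r1" "r1 < 1"
    using le_less_trans[OF r1(2) i(2)] by simp_all
  have "r = r1" if "0 < r" "r < 1" "radius_eq m M \<Lambda> r = 0" for r
    using radius_eq_strict_antimono[OF M L, of r r1] radius_eq_strict_antimono[OF M L, of r1 r]
      r1 r1' that by (cases r r1 rule: linorder_cases) auto
  then show ?thesis
    using that[of r1] r1 r1' by blast
qed

text \<open>This links the two formulas of the theorem: the part of \<open>schlicht_radius\<close>
  without the sum is a primitive of the Pick term in \<open>radius_eq\<close>.\<close>

lemma has_real_derivative_pick_bound_primitive:
  fixes \<Lambda> t :: real
  assumes "\<Lambda> > 1" "t < 1"
  shows "((\<lambda>r. \<Lambda>\<^sup>2 * r + (\<Lambda> ^ 3 - \<Lambda>) * ln (1 - r / \<Lambda>)) has_real_derivative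
    \<Lambda> * (1 - \<Lambda> * t) / (\<Lambda> - t)) (at t)"
proof -
  have pos: "1 - t / \<Lambda> > 0"
    using assms by (simp add: field_simps)
  have "inverse (1 - t / \<Lambda>) * (1 / \<Lambda>) = 1 / (\<Lambda> - t)"
    using assms by (simp add: field_simps)
  then have "\<Lambda>\<^sup>2 + (\<Lambda> ^ 3 - \<Lambda>) * (inverse (1 - t / \<Lambda>) * (- (1 / \<Lambda>))) = \<Lambda>\<^sup>2 - (\<Lambda> ^ 3 - \<Lambda>) / (\<Lambda> - t)"
    by simp
  also have "\<dots> = \<Lambda> * (1 - \<Lambda> * t) / (\<Lambda> - t)"
    using assms by (simp add: divide_simps) (simp add: algebra_simps power2_eq_square power3_eq_cube)
  finally have eq: "\<Lambda>\<^sup>2 + (\<Lambda> ^ 3 - \<Lambda>) * (inverse (1 - t / \<Lambda>) * (- (1 / \<Lambda>))) = \<Lambda> * (1 - \<Lambda> * t) / (\<Lambda> - t)" .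
  have "((\<lambda>r. 1 - r / \<Lambda>) has_real_derivative - (1 / \<Lambda>)) (at t)"
    using assms by (auto intro!: derivative_eq_intros)
  then show ?thesis
    unfolding eq[symmetric]
    by (intro DERIV_add DERIV_cmult_Id DERIV_cmult DERIV_ln pos
      DERIV_chain2[where f = ln and g = "\<lambda>r. 1 - r / \<Lambda>"])
qed

text \<open>\<open>schlicht_radius\<close> vanishes at 0, and its derivative \<open>p\<close>
  dominates \<open>radius_eq\<close> because \<open>1 / (1 - t\<^sup>2)\<close> is at least 1.
  Before its root \<open>r1\<close>, \<open>radius_eq\<close> is positive.\<close>

lemma schlicht_radius_pos:
  assumes M: "\<forall>k\<in>{1..<m}. M k \<ge> 0" and L: "\<Lambda> > 1"
    and r1: "0 < r1" "r1 < 1" "radius_eq m M \<Lambda> r1 = 0"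
  shows "schlicht_radius m M \<Lambda> r1 > 0"
proof -
  define p where "p t = \<Lambda> * (1 - \<Lambda> * t) / (\<Lambda> - t) - (\<Sum>k\<in>{1..<m}. real (k + 1) * t ^ k * M k)" for t
  have d: "(schlicht_radius m M \<Lambda> has_real_derivative p t) (at t)" if "t < 1" for t
    unfolding schlicht_radius_def p_def
  proof (intro DERIV_diff has_real_derivative_pick_bound_primitive L that DERIV_sum)
    show "((\<lambda>r. r ^ (k + 1) * M k) has_real_derivative real (k + 1) * t ^ k * M k) (at t)" for k
      using DERIV_cmult_right[OF DERIV_pow[of "k + 1" t UNIV], of "M k"] by simp
  qed
  have "schlicht_radius m M \<Lambda> 0 < schlicht_radius m M \<Lambda> r1"
  proof (rule DERIV_pos_imp_increasing_open[OF r1(1)])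
    show "continuous_on {0..r1} (schlicht_radius m M \<Lambda>)"
      using d r1 by (intro continuous_at_imp_continuous_on ballI DERIV_isCont[OF d]) auto
    fix t assume t: "0 < t" "t < r1"
    then have t2: "t\<^sup>2 < 1"
      using r1 by (simp add: power_less_one_iff)
    have "(\<Sum>k\<in>{1..<m}. real (k + 1) * t ^ k * M k)
      \<le> (\<Sum>k\<in>{1..<m}. t ^ k * (M k / (1 - t\<^sup>2) + real k * M k))"
    proof (rule sum_mono)
      fix k assume k: "k \<in> {1..<m}"
      have "M k \<le> M k / (1 - t\<^sup>2)"
        using M k t2 by (simp add: field_simps mult_left_le)
      then have "t ^ k * (M k + real k * M k) \<le> t ^ k * (M k / (1 - t\<^sup>2) + real k * M k)"
        using t by (intro mult_left_mono add_mono) auto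
      then show "real (k + 1) * t ^ k * M k \<le> t ^ k * (M k / (1 - t\<^sup>2) + real k * M k)"
        by (simp add: algebra_simps)
    qed
    then have "radius_eq m M \<Lambda> t \<le> p t"
      by (simp add: radius_eq_def p_def)
    then have "0 < p t"
      using radius_eq_strict_antimono[OF M L, of t r1] t r1 by simp
    then show "\<exists>y. (schlicht_radius m M \<Lambda> has_real_derivative y) (at t) \<and> 0 < y"
      using d t r1 by (meson less_trans)
  qed
  then show ?thesis
    by (simp add: schlicht_radius_def)
qed

section \<open>Covered discs by invariance of domain\<close>

text \<open>The image of the open disc is open, and the boundary circle is sent outside
  \<open>ball 0 R\<close>, so the image contains that ball. The required subdomain is the preimage
  of the ball.\<close>

lemma contains_schlicht_disc_if_inj:
  assumes cont: "continuous_on (cball 0 r) F" and inj: "inj_on F (ball 0 r)" and F0: "F 0 = 0"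
    and r: "0 < r" and R: "0 < R" and ge: "\<And>z. norm z = r \<Longrightarrow> R \<le> norm (F z)"
  shows "contains_schlicht_disc F (ball 0 r) R"
proof -
  have cont': "continuous_on (ball 0 r) F"
    using cont by (rule continuous_on_subset) auto
  have "ball (F 0) R \<subseteq> F ` ball 0 r"
  proof (rule ball_subset_open_map_image)
    show "open (F ` interior (ball 0 r))"
      using invariance_of_domain[OF cont' open_ball inj] by simp
    show "continuous_on (closure (ball 0 r)) F"
      using cont r by simp
    show "R \<le> norm (F z - F 0)" if "z \<in> frontier (ball 0 r)" for z
      using that r ge F0 by simp
  qed (use r R in auto)
  then have sub: "ball 0 R \<subseteq> F ` ball 0 r"
    using F0 by simp
  obtain g where g: "homeomorphism (ball 0 r) (F ` ball 0 r) F g"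
    using invariance_of_domain_homeomorphism[OF open_ball cont' _ inj] by auto
  define U where "U = ball 0 r \<inter> F -` ball 0 R"
  have "open U"
    unfolding U_def by (intro continuous_open_preimage cont') auto
  moreover have "F ` U = ball 0 R"
    using sub by (auto simp: U_def)
  \<comment> \<open>Connectedness of \<open>U\<close> comes from here: it is the image of a disc
    under the continuous inverse \<open>g\<close>.\<close>
  moreover have "U = g ` ball 0 R"
  proof
    show "U \<subseteq> g ` ball 0 R"
      using g by (force simp: U_def homeomorphism_def)
    show "g ` ball 0 R \<subseteq> U"
      using g sub unfolding U_def homeomorphism_def by (auto simp: subset_iff)
  qed
  moreover have "continuous_on (ball 0 R) g"
    using g sub by (meson continuous_on_subset homeomorphism_cont2)
  ultimately show ?thesis
    unfolding contains_schlicht_disc_def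
    using R inj by (intro exI[of _ U]) (auto simp: U_def intro: connected_continuous_image inj_on_subset)
qed

section \<open>Univalence and covering for admissible functions\<close>

lemma admissible_consequences:
  assumes m: "m \<ge> 1" and adm: "admissible m M \<Lambda> f F"
  shows "deriv (f 0) 0 = 1" and "\<Lambda> > 1"
    and "z \<in> ball 0 1 \<Longrightarrow> F z = f 0 z + (\<Sum>k\<in>{1..<m}. cnj z ^ k * f k z)"
proof -
  have "wirtinger_z F 0 = deriv (f 0) 0"
    using adm m by (intro wirtinger_z_eq_deriv) (auto simp: admissible_def)
  then show one: "deriv (f 0) 0 = 1"
    using adm by (simp add: admissible_def)
  have "norm (deriv (f 0) 0) < \<Lambda>"
    using adm by (simp add: admissible_def)
  then show "\<Lambda> > 1"
    using one by simp
  show "F z = f 0 z + (\<Sum>k\<in>{1..<m}. cnj z ^ k * f k z)" if "z \<in> ball 0 1"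
    using adm that m by (simp add: admissible_def lessThan_atLeast0 sum.atLeast_Suc_lessThan)
qed

lemma admissible_Re_deriv_lower_bound:
  assumes m: "m \<ge> 1" and adm: "admissible m M \<Lambda> f F" and z: "z \<in> ball 0 1"
  shows "Re (deriv (f 0) z) \<ge> \<Lambda> * (1 - \<Lambda> * norm z) / (\<Lambda> - norm z)"
  using adm m admissible_consequences(1)[OF m adm] z
  by (intro Schwarz_Pick_Re_lower_bound holomorphic_deriv) (auto simp: admissible_def)

text \<open>\<open>radius_eq\<close> is the expansion constant of \<open>f 0\<close> minus the
  Lipschitz constants of the other terms. The Pick bound decreases in \<open>norm u\<close>, so its
  value at \<open>r\<close> serves the whole closed disc.\<close>

lemma admissible_expansive:
  assumes m: "m \<ge> 1" and adm: "admissible m M \<Lambda> f F"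
    and r: "r < 1" and zw: "z \<in> cball 0 r" "w \<in> cball 0 r"
  shows "radius_eq m M \<Lambda> r * norm (z - w) \<le> norm (F z - F w)"
proof -
  note L = admissible_consequences(2)[OF m adm]
  note F = admissible_consequences(3)[OF m adm]
  have sub: "cball 0 r \<subseteq> ball (0::complex) 1" using r by auto
  have seg: "closed_segment w z \<subseteq> cball 0 r"
    using zw by (intro closed_segment_subset) auto
  define b where "b = \<Lambda> * (1 - \<Lambda> * r) / (\<Lambda> - r)"
  define h where "h k u = cnj u ^ k * f k u" for k u
  have "Re (deriv (f 0) u) \<ge> b" if "u \<in> open_segment w z" for u
  proof -
    have u: "norm u \<le> r" "u \<in> ball 0 1"
      using that seg sub by (auto simp: open_segment_def)
    have "b \<le> \<Lambda> * (1 - \<Lambda> * norm u) / (\<Lambda> - norm u)"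
      using pick_bound_strict_antimono[OF L _ r, of "norm u"] u(1)
      by (cases "norm u = r") (auto simp: b_def)
    then show ?thesis
      using admissible_Re_deriv_lower_bound[OF m adm u(2)] by simp
  qed
  then have f0: "b * norm (z - w) \<le> norm (f 0 z - f 0 w)"
    using adm m seg sub
    by (intro holomorphic_expansive_if_Re_deriv_ge[of _ "ball 0 1"]) (auto simp: admissible_def)
  have "norm (h k z - h k w) \<le> r ^ k * (M k / (1 - r\<^sup>2) + real k * M k) * norm (z - w)"
    if "k \<in> {1..<m}" for k
    unfolding h_def using adm that r zw
    by (intro Lipschitz_cnj_power_mult) (auto simp: admissible_def)
  then have "norm (\<Sum>k\<in>{1..<m}. h k z - h k w)
    \<le> (\<Sum>k\<in>{1..<m}. r ^ k * (M k / (1 - r\<^sup>2) + real k * M k)) * norm (z - w)"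
    unfolding sum_distrib_right by (rule sum_norm_le)
  moreover have "F z - F w = (f 0 z - f 0 w) + (\<Sum>k\<in>{1..<m}. h k z - h k w)"
    using F[of z] F[of w] zw r by (simp add: h_def sum_subtractf)
  then have "norm (f 0 z - f 0 w) \<le> norm (F z - F w) + norm (\<Sum>k\<in>{1..<m}. h k z - h k w)"
    by (metis add_diff_cancel_right' norm_triangle_ineq4)
  ultimately show ?thesis
    using f0 by (simp add: radius_eq_def b_def left_diff_distrib)
qed

lemma admissible_norm_lower_bound:
  assumes m: "m \<ge> 1" and adm: "admissible m M \<Lambda> f F" and z: "z \<in> ball 0 1"
  shows "schlicht_radius m M \<Lambda> (norm z) \<le> norm (F z)"
proof -
  note L = admissible_consequences(2)[OF m adm]
  have "\<Lambda>\<^sup>2 * norm z + (\<Lambda> ^ 3 - \<Lambda>) * ln (1 - norm z / \<Lambda>) \<le> norm (f 0 z)"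
    by (rule norm_ge_if_Re_deriv_ge[where p = "\<lambda>t. \<Lambda> * (1 - \<Lambda> * t) / (\<Lambda> - t)"])
       (use adm m z L admissible_Re_deriv_lower_bound[OF m adm] in
         \<open>auto simp: admissible_def intro!: has_real_derivative_pick_bound_primitive\<close>)
  moreover have "norm (cnj z ^ k * f k z) \<le> norm z ^ (k + 1) * M k" if "k \<in> {1..<m}" for k
  proof -
    have "norm (f k z) \<le> M k * norm z"
      using adm that z by (intro Schwarz_bound) (auto simp: admissible_def)
    then have "norm z ^ k * norm (f k z) \<le> norm z ^ k * (M k * norm z)"
      by (intro mult_left_mono) auto
    then show ?thesis
      by (simp add: norm_mult norm_power mult_ac)
  qed
  then have "norm (\<Sum>k\<in>{1..<m}. cnj z ^ k * f k z) \<le> (\<Sum>k\<in>{1..<m}. norm z ^ (k + 1) * M k)"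
    by (rule sum_norm_le)
  moreover have "norm (f 0 z) - norm (\<Sum>k\<in>{1..<m}. cnj z ^ k * f k z) \<le> norm (F z)"
    unfolding admissible_consequences(3)[OF m adm z] by (rule norm_diff_ineq)
  ultimately show ?thesis
    by (simp add: schlicht_radius_def)
qed

lemma admissible_inj_and_schlicht:
  assumes m: "m \<ge> 1" and M: "\<forall>k\<in>{1..<m}. M k \<ge> 0" and adm: "admissible m M \<Lambda> f F"
    and r1: "0 < r1" "r1 < 1" "radius_eq m M \<Lambda> r1 = 0"
  shows "inj_on F (ball 0 r1)"
    and "contains_schlicht_disc F (ball 0 r1) (schlicht_radius m M \<Lambda> r1)"
proof -
  note L = admissible_consequences(2)[OF m adm]
  show inj: "inj_on F (ball 0 r1)"
  proof (rule inj_onI)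
    fix z w assume zw: "z \<in> ball 0 r1" "w \<in> ball 0 r1" "F z = F w"
    \<comment> \<open>Both points lie in a closed disc of radius strictly below \<open>r1\<close>,
      where the expansion constant is still positive.\<close>
    define r where "r = max (norm z) (norm w)"
    have r: "0 \<le> r" "r < r1" "z \<in> cball 0 r" "w \<in> cball 0 r"
      using zw by (auto simp: r_def max_def)
    have "radius_eq m M \<Lambda> r > 0"
      using radius_eq_strict_antimono[OF M L r(1,2)] r1 by simp
    moreover have "radius_eq m M \<Lambda> r * norm (z - w) \<le> 0"
      using admissible_expansive[OF m adm _ r(3,4)] r r1 zw(3) by simp
    ultimately show "z = w"
      by (simp add: mult_le_0_iff)
  qed
  have sub: "cball 0 r1 \<subseteq> ball (0::complex) 1"
    using r1 by auto
  have "continuous_on (ball 0 1) (\<lambda>z. \<Sum>k<m. cnj z ^ k * f k z)"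
    using adm by (intro continuous_intros) (auto simp: admissible_def holomorphic_on_imp_continuous_on)
  then have "continuous_on (ball 0 1) F"
    by (rule continuous_on_eq) (use adm in \<open>auto simp: admissible_def\<close>)
  then have cont: "continuous_on (cball 0 r1) F"
    using sub by (rule continuous_on_subset)
  show "contains_schlicht_disc F (ball 0 r1) (schlicht_radius m M \<Lambda> r1)"
  proof (rule contains_schlicht_disc_if_inj[OF cont inj _ r1(1) schlicht_radius_pos[OF M L r1]])
    show "F 0 = 0"
      using adm by (simp add: admissible_def)
    show "schlicht_radius m M \<Lambda> r1 \<le> norm (F z)" if "norm z = r1" for z
      using admissible_norm_lower_bound[OF m adm, of z] that r1 by simp
  qed
qed

section \<open>The extremal function and sharpness\<close>

text \<open>The complex counterpart of \<open>schlicht_radius\<close> without its sum. For \<Lambda>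
  above 1 it is, on the unit disc, the primitive vanishing at 0 of the function for which the
  Schwarz-Pick bound is attained.\<close>

definition extremal :: "real \<Rightarrow> complex \<Rightarrow> complex" where
  "extremal \<Lambda> z = of_real (\<Lambda>\<^sup>2) * z + of_real (\<Lambda> ^ 3 - \<Lambda>) * Ln (1 - z / of_real \<Lambda>)"

text \<open>In the disc \<open>1 - z / of_real \<Lambda>\<close> has positive real part and so
  avoids the branch cut of \<open>Ln\<close>. With the derivative in Moebius form, its bound by
  \<Lambda> and its zero at \<open>1 / \<Lambda>\<close> can be read off.\<close>

lemma extremal_has_derivative:
  assumes L: "\<Lambda> > 1" and z: "z \<in> ball 0 1"
  shows "(extremal \<Lambda> has_field_derivative
    - of_real \<Lambda> * Moebius_function 0 (of_real (1 / \<Lambda>)) z) (at z)"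
proof -
  have "norm (z / of_real \<Lambda>) < 1"
    using L z by (simp add: norm_divide)
  then have "Re (1 - z / of_real \<Lambda>) > 0"
    using complex_Re_le_cmod[of "z / of_real \<Lambda>"] by simp
  then have nonpos: "1 - z / of_real \<Lambda> \<notin> \<real>\<^sub>\<le>\<^sub>0"
    using complex_nonpos_Reals_iff by force
  have ne: "of_real \<Lambda> - z \<noteq> 0"
    using L z by auto
  have inv: "inverse (1 - z / of_real \<Lambda>) = of_real \<Lambda> / (of_real \<Lambda> - z)"
    using L ne by (simp add: field_simps)
  have "of_real (\<Lambda>\<^sup>2) + of_real (\<Lambda> ^ 3 - \<Lambda>) * (inverse (1 - z / of_real \<Lambda>) * - (1 / of_real \<Lambda>))
    = - of_real \<Lambda> * Moebius_function 0 (of_real (1 / \<Lambda>)) z"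
    unfolding Moebius_function_simple inv using L ne
    by (simp add: divide_simps) (simp add: algebra_simps power2_eq_square power3_eq_cube)
  note eq = this[symmetric]
  have "((\<lambda>z. 1 - z / of_real \<Lambda>) has_field_derivative - (1 / of_real \<Lambda>)) (at z)"
    using L by (auto intro!: derivative_eq_intros)
  then show ?thesis
    unfolding extremal_def[abs_def] eq
    by (intro DERIV_add DERIV_cmult_Id DERIV_cmult has_field_derivative_Ln nonpos
      DERIV_chain2[where f = Ln and g = "\<lambda>z. 1 - z / of_real \<Lambda>"])
qed

lemma deriv_extremal:
  assumes "\<Lambda> > 1" "z \<in> ball 0 1"
  shows "deriv (extremal \<Lambda>) z = - of_real \<Lambda> * Moebius_function 0 (of_real (1 / \<Lambda>)) z"
  using extremal_has_derivative[OF assms] by (rule DERIV_imp_deriv)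

lemma extremal_holomorphic:
  assumes "\<Lambda> > 1"
  shows "extremal \<Lambda> holomorphic_on ball 0 1"
  using extremal_has_derivative[OF assms]
  by (auto simp only: holomorphic_on_open open_ball)

lemma extremal_admissible:
  assumes m: "m \<ge> 1" and M: "\<forall>k\<in>{1..<m}. M k \<ge> 0" and L: "\<Lambda> > 1"
  shows "admissible m M \<Lambda> (\<lambda>k z. if k = 0 then extremal \<Lambda> z else 0) (extremal \<Lambda>)"
proof -
  let ?f = "\<lambda>k z. if k = (0::nat) then extremal \<Lambda> z else 0"
  have hol: "?f k holomorphic_on ball 0 1" for k
    using extremal_holomorphic[OF L] by (cases "k = 0") auto
  have zero: "?f k 0 = 0" for k
    by (simp add: extremal_def)
  have F: "extremal \<Lambda> z = (\<Sum>k<m. cnj z ^ k * ?f k z)" for z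
  proof -
    have "(\<Sum>k<m. cnj z ^ k * ?f k z) = (\<Sum>k<m. if k = 0 then extremal \<Lambda> z else 0)"
      by (intro sum.cong) auto
    then show ?thesis
      using m by (simp add: sum.delta)
  qed
  have "wirtinger_z (extremal \<Lambda>) 0 = deriv (?f 0) 0"
    by (rule wirtinger_z_eq_deriv[OF hol m zero F])
  also have "\<dots> = 1"
    using L by (simp add: deriv_extremal Moebius_function_of_zero)
  finally have one: "wirtinger_z (extremal \<Lambda>) 0 = 1" .
  have "norm (deriv (?f 0) z) < \<Lambda>" if "z \<in> ball 0 1" for z
  proof -
    have "norm (Moebius_function 0 (of_real (1 / \<Lambda>)) z) < 1"
      using that L by (intro Moebius_function_norm_lt_1) (auto simp: norm_divide)
    then show ?thesis
      using that L by (simp add: deriv_extremal norm_mult)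
  qed
  then show ?thesis
    unfolding admissible_def using hol zero F one M by auto
qed

lemma extremal_at_critical_point:
  assumes L: "\<Lambda> > 1" and M: "\<forall>k\<in>{1..<m}. M k = 0"
  shows "extremal \<Lambda> (of_real (1 / \<Lambda>)) = of_real (schlicht_radius m M \<Lambda> (1 / \<Lambda>))"
proof -
  have "1 - 1 / \<Lambda> / \<Lambda> > 0"
    using L by (simp add: field_simps less_1_mult)
  then have "Ln (of_real (1 - 1 / \<Lambda> / \<Lambda>)) = of_real (ln (1 - 1 / \<Lambda> / \<Lambda>))"
    by (rule Ln_of_real)
  then show ?thesis
    using M by (simp add: extremal_def schlicht_radius_def)
qed

lemma radius_eq_root_if_zero:
  assumes L: "\<Lambda> > 1" and M: "\<forall>k\<in>{1..<m}. M k = 0"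
  shows "{r. 0 < r \<and> r < 1 \<and> radius_eq m M \<Lambda> r = 0} = {1 / \<Lambda>}"
  using assms by (auto simp: radius_eq_def field_simps)

text \<open>An injective holomorphic function on an open set has no critical point, but
  \<open>1 / \<Lambda>\<close> is one and lies inside the larger disc.\<close>

lemma extremal_not_inj:
  assumes L: "\<Lambda> > 1" and r: "1 / \<Lambda> < r" "r \<le> 1"
  shows "\<not> inj_on (extremal \<Lambda>) (ball 0 r)"
proof
  assume inj: "inj_on (extremal \<Lambda>) (ball 0 r)"
  have "extremal \<Lambda> holomorphic_on ball 0 r"
    using r by (intro holomorphic_on_subset[OF extremal_holomorphic[OF L]]) auto
  then have "deriv (extremal \<Lambda>) (of_real (1 / \<Lambda>)) \<noteq> 0"
    using L r by (intro holomorphic_injective_imp_regular[OF _ open_ball inj]) (auto simp: norm_divide)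
  then show False
    using L by (simp add: deriv_extremal norm_divide Moebius_function_eq_zero)
qed

text \<open>The segment from an interior point \<open>w\<close> to the boundary point
  \<open>c\<close> meets the circle only at \<open>c\<close>. On its interior the derivative has
  positive real part, so the value at \<open>c\<close> cannot already be taken at
  \<open>w\<close>.\<close>

lemma extremal_omits:
  assumes L: "\<Lambda> > 1"
  shows "extremal \<Lambda> (of_real (1 / \<Lambda>)) \<notin> extremal \<Lambda> ` ball 0 (1 / \<Lambda>)"
proof
  define c where "c = complex_of_real (1 / \<Lambda>)"
  assume "extremal \<Lambda> (of_real (1 / \<Lambda>)) \<in> extremal \<Lambda> ` ball 0 (1 / \<Lambda>)"
  then obtain w where w: "w \<in> ball 0 (1 / \<Lambda>)" and eq: "extremal \<Lambda> w = extremal \<Lambda> c"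
    by (auto simp: c_def)
  have c: "norm c = 1 / \<Lambda>" and i: "0 < 1 / \<Lambda>" "1 / \<Lambda> < 1"
    using L by (auto simp: c_def norm_divide)
  have sub: "cball 0 (1 / \<Lambda>) \<subseteq> ball (0::complex) 1"
    using i(2) by (meson le_less_trans mem_ball_0 mem_cball_0 subsetI)
  have os: "open_segment w c \<subseteq> ball 0 (1 / \<Lambda>)"
    using in_interior_closure_convex_segment[of "ball 0 (1 / \<Lambda>)" w c] w c i by simp
  \<comment> \<open>The case \<open>m = 1\<close> gives access to the general lower bound on the
    real part of the derivative.\<close>
  have adm: "admissible 1 (\<lambda>_. 0) \<Lambda> (\<lambda>k z. if k = 0 then extremal \<Lambda> z else 0) (extremal \<Lambda>)"
    using L by (intro extremal_admissible) auto
  have "extremal \<Lambda> w \<noteq> extremal \<Lambda> c"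
  proof (rule holomorphic_neq_if_Re_deriv_pos[OF extremal_holomorphic[OF L] open_ball])
    have "closed_segment w c \<subseteq> cball 0 (1 / \<Lambda>)"
      using w c by (intro closed_segment_subset) auto
    then show "closed_segment w c \<subseteq> ball 0 1"
      using sub by blast
    show "w \<noteq> c"
      using w c by auto
    fix u assume "u \<in> open_segment w c"
    then have "u \<in> ball 0 (1 / \<Lambda>)"
      using os by blast
    then have u: "norm u < 1 / \<Lambda>" "u \<in> ball 0 1"
      using less_trans[OF _ i(2)] by simp_all
    have "0 < \<Lambda> * (1 - \<Lambda> * norm u) / (\<Lambda> - norm u)"
      using u L by (intro divide_pos_pos mult_pos_pos) (auto simp: field_simps)
    then show "0 < Re (deriv (extremal \<Lambda>) u)"
      using admissible_Re_deriv_lower_bound[OF _ adm u(2)] by simp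
  qed
  then show False using eq by simp
qed

theorem theorem3p1:
  fixes m :: nat and M :: "nat \<Rightarrow> real"
  assumes "m \<ge> 1"
    and "\<forall>k\<in>{1..<m}. M k \<ge> 0"
  shows
    "(\<forall>(\<Lambda>::real) f F. admissible m M \<Lambda> f F \<longrightarrow>
        \<Lambda> > 1 \<and>
        (\<exists>r1. {r. 0 < r \<and> r < 1 \<and> radius_eq m M \<Lambda> r = 0} = {r1} \<and>
           inj_on F (ball 0 r1) \<and>
           contains_schlicht_disc F (ball 0 r1) (schlicht_radius m M \<Lambda> r1))) \<and>
     ((\<forall>k\<in>{1..<m}. M k = 0) \<longrightarrow>
        (\<forall>\<Lambda>>1. \<exists>r1. {r. 0 < r \<and> r < 1 \<and> radius_eq m M \<Lambda> r = 0} = {r1} \<and>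
           \<not> (\<exists>r. r1 < r \<and> r \<le> 1 \<and>
                 (\<forall>f F. admissible m M \<Lambda> f F \<longrightarrow> inj_on F (ball 0 r))) \<and>
           \<not> (\<exists>R. R > schlicht_radius m M \<Lambda> r1 \<and>
                 (\<forall>f F. admissible m M \<Lambda> f F \<longrightarrow> ball 0 R \<subseteq> F ` ball 0 r1))))"
proof (intro conjI impI allI)
  fix \<Lambda> f F assume adm: "admissible m M \<Lambda> f F"
  show L: "\<Lambda> > 1"
    by (rule admissible_consequences(2)[OF assms(1) adm])
  obtain r1 where r1: "{r. 0 < r \<and> r < 1 \<and> radius_eq m M \<Lambda> r = 0} = {r1}"
    by (rule radius_eq_unique_root[OF assms(2) L])
  then have "0 < r1" "r1 < 1" "radius_eq m M \<Lambda> r1 = 0"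
    by blast+
  from admissible_inj_and_schlicht[OF assms adm this] r1
  show "\<exists>r1. {r. 0 < r \<and> r < 1 \<and> radius_eq m M \<Lambda> r = 0} = {r1} \<and> inj_on F (ball 0 r1) \<and>
    contains_schlicht_disc F (ball 0 r1) (schlicht_radius m M \<Lambda> r1)"
    by blast
next
  fix \<Lambda> :: real assume M: "\<forall>k\<in>{1..<m}. M k = 0" and L: "\<Lambda> > 1"
  note root = radius_eq_root_if_zero[OF L M]
  note adm = extremal_admissible[OF assms L]
  have "1 / \<Lambda> \<in> {r. 0 < r \<and> r < 1 \<and> radius_eq m M \<Lambda> r = 0}"
    unfolding root by simp
  \<comment> \<open>Positivity makes the critical value equal to its own norm, so this omitted value
    lies in every disc of larger radius.\<close>
  then have pos: "schlicht_radius m M \<Lambda> (1 / \<Lambda>) > 0"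
    using schlicht_radius_pos[OF assms(2) L] by blast
  have "\<not> ball 0 R \<subseteq> extremal \<Lambda> ` ball 0 (1 / \<Lambda>)" if "R > schlicht_radius m M \<Lambda> (1 / \<Lambda>)" for R
  proof -
    have "extremal \<Lambda> (of_real (1 / \<Lambda>)) \<in> ball 0 R"
      unfolding extremal_at_critical_point[OF L M] using that pos by simp
    then show ?thesis
      using extremal_omits[OF L] by blast
  qed
  then have "\<not> (\<exists>R. R > schlicht_radius m M \<Lambda> (1 / \<Lambda>) \<and>
      (\<forall>f F. admissible m M \<Lambda> f F \<longrightarrow> ball 0 R \<subseteq> F ` ball 0 (1 / \<Lambda>)))"
    using adm by metis
  moreover have "\<not> (\<exists>r. 1 / \<Lambda> < r \<and> r \<le> 1 \<and> (\<forall>f F. admissible m M \<Lambda> f F \<longrightarrow> inj_on F (ball 0 r)))"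
    using adm extremal_not_inj[OF L] by metis
  ultimately show "\<exists>r1. {r. 0 < r \<and> r < 1 \<and> radius_eq m M \<Lambda> r = 0} = {r1} \<and>
     \<not> (\<exists>r. r1 < r \<and> r \<le> 1 \<and> (\<forall>f F. admissible m M \<Lambda> f F \<longrightarrow> inj_on F (ball 0 r))) \<and>
     \<not> (\<exists>R. R > schlicht_radius m M \<Lambda> r1 \<and>
        (\<forall>f F. admissible m M \<Lambda> f F \<longrightarrow> ball 0 R \<subseteq> F ` ball 0 r1))"
    using root by (intro exI[of _ "1 / \<Lambda>"] conjI)
qed

end
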